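(* Let $\omega=\{0,1\}$, let $f(x)=x$ on $\omega$, and let $P$ and $Q$ be Bernoulli distributions on $\omega$ with probability mass functions $P(0)=1-p$, $P(1)=p$ and $Q(0)=1-q$, $Q(1)=q$, where $p,q\in(0,1)$. Let $E_P=E_P[f]$ and $E_Q=E_Q[f]$ be the expected values of $f$ under $P$ and $Q$. Then there exists a function $C:[0,1]\to\mathbb{R}$ such that $$\frac{Q(x)-P(x)}{P(x)+t\,(Q(x)-P(x))}=\bigl(f(x)-E_P-t(E_Q-E_P)\bigr)\,C(t)$$ for all $x\in\omega$ and all $t\in[0,1]$.
   Context: For a function $f$ on $\{0,1\}$, $E_P[f]:=\sum_{x\in\{0,1\}}P(x)f(x)$, and similarly for $Q$. The displayed condition is the one the paper gives as the equality condition for its lower bound $\mathrm{KL}(P\|Q)\ge\frac{A-2V_P}{D}\tanh^{-1}\frac{D}{A}+\frac12\log\frac{V_P}{V_Q}$, where $V_P,V_Q$ are the variances of $f$ under $P,Q$, $A=(E_Q-E_P)^2+V_P+V_Q$ and $D=\sqrt{A^2-4V_PV_Q}$. *)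

theory Defs
  imports "HOL-Probability.Probability"
begin

definition binary_expectation :: "nat pmf \<Rightarrow> (nat \<Rightarrow> real) \<Rightarrow> real" where
  "binary_expectation P f = (\<Sum>x\<in>{0, 1}. pmf P x * f x)"

lemma binary_expectation_eq:
  assumes "set_pmf P \<subseteq> {0, 1}"
  shows "binary_expectation P f = measure_pmf.expectation P f"
  unfolding binary_expectation_def using assms
  by (subst integral_measure_pmf[where A = "{0, 1}"]) auto

end

theory Submission
  imports Defs
begin

text \<open>The mixture of \<open>P\<close> and \<open>Q\<close> with weight \<open>t\<close> is Bernoulli with parameter
  \<open>m t = p + t * (q - p)\<close>, and \<open>C t\<close> is \<open>q - p\<close> divided by its variance \<open>m t * (1 - m t)\<close>.\<close>

theorem proposition1:
  fixes p q :: real and P Q :: "nat pmf" and \<omega> :: "nat set"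
    and f :: "nat \<Rightarrow> real" and E\<^sub>P E\<^sub>Q :: real
  assumes "\<omega> = {0, 1}"
    and "\<And>x. x \<in> \<omega> \<Longrightarrow> f x = real x"
    and "0 < p" "p < 1" "0 < q" "q < 1"
    and "pmf P 0 = 1 - p" "pmf P 1 = p"
    and "pmf Q 0 = 1 - q" "pmf Q 1 = q"
    and "E\<^sub>P = binary_expectation P f"
    and "E\<^sub>Q = binary_expectation Q f"
  shows "\<exists>C :: real \<Rightarrow> real. \<forall>x\<in>\<omega>. \<forall>t\<in>{0..1}.
    (pmf Q x - pmf P x) / (pmf P x + t * (pmf Q x - pmf P x))
      = (f x - E\<^sub>P - t * (E\<^sub>Q - E\<^sub>P)) * C t"
proof -
  have E: "E\<^sub>P = p" "E\<^sub>Q = q"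
    using assms by (simp_all add: binary_expectation_def)
  define m where "m t = p + t * (q - p)" for t
  have m_bounds: "0 < m t" "m t < 1" if "t \<in> {0..1}" for t
  proof -
    \<comment> \<open>As a convex combination, \<open>m t\<close> inherits the strict bounds 0 and 1
      from \<open>p\<close> and \<open>q\<close>.\<close>
    have m_eq: "m t = (1 - t) * p + t * q"
      by (simp add: m_def algebra_simps)
    \<comment> \<open>At \<open>t = 0\<close> only \<open>p\<close> gives positivity; otherwise
      \<open>t * q\<close> is positive and the other summand nonnegative.\<close>
    show "0 < m t"
      unfolding m_eq using that assms(3,5)
      by (cases "t = 0") (auto intro!: add_nonneg_pos)
    show "m t < 1"
      unfolding m_eq using that assms(4,6)
      by (intro convex_bound_lt) auto
  qed
  show ?thesis
  proof (intro exI[of _ "\<lambda>t. (q - p) / (m t * (1 - m t))"] ballI)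
    fix x and t :: real
    assume x: "x \<in> \<omega>" and t: "t \<in> {0..1}"
    \<comment> \<open>This is the deviation of \<open>x\<close> from the mixture mean:
      \<open>- m t\<close> at 0, \<open>1 - m t\<close> at 1. Either value cancels one factor of the
      variance.\<close>
    have fx: "f x - E\<^sub>P - t * (E\<^sub>Q - E\<^sub>P) = real x - m t"
      using assms(2)[OF x] by (simp add: E m_def)
    from x assms(1) consider "x = 0" | "x = 1"
      by auto
    then show "(pmf Q x - pmf P x) / (pmf P x + t * (pmf Q x - pmf P x))
        = (f x - E\<^sub>P - t * (E\<^sub>Q - E\<^sub>P)) * ((q - p) / (m t * (1 - m t)))"
    proof cases
      case 1
      have num: "pmf Q 0 - pmf P 0 = p - q"
        by (simp add: assms(7,9))
      \<comment> \<open>The mixture mass at 0, written with \<open>p - q\<close> to match the goal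
        once \<open>num\<close> has been rewritten.\<close>
      have den: "pmf P 0 + t * (p - q) = 1 - m t"
        by (simp add: assms(7) m_def algebra_simps)
      show ?thesis
        unfolding fx unfolding 1 num den using m_bounds[OF t] by (simp add: field_simps)
    next
      case 2
      have num: "pmf Q 1 - pmf P 1 = q - p"
        unfolding assms(8,10) ..
      have den: "pmf P 1 + t * (q - p) = m t"
        by (simp only: assms(8) m_def)
      \<comment> \<open>Here \<open>1 - m t\<close> cancels, which needs
        \<open>m t < 1\<close>.\<close>
      show ?thesis
        unfolding fx unfolding 2 num den using m_bounds[OF t] by (simp add: field_simps)
    qed
  qed
qed

end
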